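(* Let $m\ge 1$, let $\omega=(w_1,\ldots,w_m)$ be a probability vector, let $A_1,\ldots,A_m\in\mathrm{UT}_2$ and $c>0$. Let $D=\operatorname{diag}(A_1^{w_1}\cdots A_m^{w_m})$, write $D^{-1}A_i=\begin{bmatrix} a_{11}^{(i)} & a_{12}^{(i)}\\ 0 & a_{22}^{(i)}\end{bmatrix}$, and let $c_0=\sum_{i=1}^m w_i\, f\bigl(a_{22}^{(i)}/a_{11}^{(i)},1\bigr)$. Suppose $X_0\in\mathrm{UT}_2$ satisfies $\operatorname{diag}(X_0)=D$ and $X_0\neq G(\omega;A_1,\ldots,A_m)$, and let $\{X_k\}$ be generated from $X_0$ by the projection mean iteration $$\log(X_k^{-1}X_{k+1})=\frac1c\sum_{i=1}^m w_i\log(X_k^{-1}A_i),\qquad k\ge 0.$$ Then $\{X_k\}$ converges to the Karcher mean $G(\omega;A_1,\ldots,A_m)$ if and only if $c>c_0/2$. In particular: (1) the iteration diverges (i.e. $\{X_k\}$ does not converge) whenever $c\in(0,1/2]$; (2) if the weight vector $\omega$ has at least two positive entries, there exists no constant $c>0$ for which the iteration, initialized at $X_0=D$ (where $D=\operatorname{diag}(A_1^{w_1}\cdots A_m^{w_m})$ depends on the $A_i$), converges for every choice of $A_1,\ldots,A_m\in\mathrm{UT}_2$.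
   Context: $\mathrm{UT}_2$ is the group of $2\times 2$ real upper triangular matrices with positive diagonal entries. A probability vector has nonnegative entries summing to $1$. For $A\in\mathrm{UT}_2$, $\log A$ is the principal logarithm (the unique real upper triangular matrix $L$ with $\exp L=A$), and $A^{p}=\exp(p\log A)$ for $p\in\mathbb{R}$. $\operatorname{diag}(A)$ is the diagonal matrix formed from the diagonal entries of $A$. For $x,y>0$, $f(x,y)=\dfrac{\log x-\log y}{x-y}$ if $x\neq y$, and $f(x,x)=1/x$. The Karcher mean $G(\omega;A_1,\ldots,A_m)$ is the solution $X\in\mathrm{UT}_2$ of $\sum_i w_i\log(X^{-1}A_i)=0$; on $\mathrm{UT}_2$ it exists and is unique for all inputs. The iteration is equivalently $X_{k+1}=X_k\exp\left(\frac1c\sum_i w_i\log(X_k^{-1}A_i)\right)$. *)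

theory Defs
  imports "HOL-Analysis.Analysis"
begin

definition UT2 :: "(real^2^2) set" where
  "UT2 = {A. A $ 2 $ 1 = 0 \<and> A $ 1 $ 1 > 0 \<and> A $ 2 $ 2 > 0}"

definition upper_triangular2 :: "real^2^2 \<Rightarrow> bool" where
  "upper_triangular2 L \<longleftrightarrow> L $ 2 $ 1 = 0"

definition diag_part :: "real^2^2 \<Rightarrow> real^2^2" where
  "diag_part A = (\<chi> i j. if i = j then A $ i $ j else 0)"

(* The operations * and ^ on vectors of vectors are componentwise, so the library's exp is not
   available for matrices; the exponential series is written with iterated matrix products. *)
definition mat_exp :: "real^2^2 \<Rightarrow> real^2^2" where
  "mat_exp L = (\<Sum>n. (1 / fact n) *\<^sub>R ((\<lambda>P. L ** P) ^^ n) (mat 1))"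

(* Meaningful for A in UT2, where exactly one such L exists. *)
definition mat_log :: "real^2^2 \<Rightarrow> real^2^2" where
  "mat_log A = (THE L. upper_triangular2 L \<and> mat_exp L = A)"

definition mat_rpow :: "real^2^2 \<Rightarrow> real \<Rightarrow> real^2^2" where
  "mat_rpow A p = mat_exp (p *\<^sub>R mat_log A)"

definition prob_vector :: "nat \<Rightarrow> (nat \<Rightarrow> real) \<Rightarrow> bool" where
  "prob_vector m w \<longleftrightarrow> (\<forall>i\<in>{1..m}. 0 \<le> w i) \<and> (\<Sum>i=1..m. w i) = 1"

(* The ordered product A_1^(w_1) ** ... ** A_m^(w_m). *)
definition weighted_prod :: "nat \<Rightarrow> (nat \<Rightarrow> real) \<Rightarrow> (nat \<Rightarrow> real^2^2) \<Rightarrow> real^2^2" where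
  "weighted_prod m w A = foldr (\<lambda>i P. mat_rpow (A i) (w i) ** P) [1..<Suc m] (mat 1)"

definition diag_prod :: "nat \<Rightarrow> (nat \<Rightarrow> real) \<Rightarrow> (nat \<Rightarrow> real^2^2) \<Rightarrow> real^2^2" where
  "diag_prod m w A = diag_part (weighted_prod m w A)"

definition log_quot :: "real \<Rightarrow> real \<Rightarrow> real" where
  "log_quot x y = (if x = y then 1 / x else (ln x - ln y) / (x - y))"

definition crit_const :: "nat \<Rightarrow> (nat \<Rightarrow> real) \<Rightarrow> (nat \<Rightarrow> real^2^2) \<Rightarrow> real" where
  "crit_const m w A =
     (\<Sum>i=1..m. w i *
        (let B = matrix_inv (diag_prod m w A) ** A i in log_quot (B $ 2 $ 2 / B $ 1 $ 1) 1))"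

definition log_mean_field ::
    "nat \<Rightarrow> (nat \<Rightarrow> real) \<Rightarrow> (nat \<Rightarrow> real^2^2) \<Rightarrow> real^2^2 \<Rightarrow> real^2^2" where
  "log_mean_field m w A X = (\<Sum>i=1..m. w i *\<^sub>R mat_log (matrix_inv X ** A i))"

definition karcher_mean :: "nat \<Rightarrow> (nat \<Rightarrow> real) \<Rightarrow> (nat \<Rightarrow> real^2^2) \<Rightarrow> real^2^2" where
  "karcher_mean m w A = (THE X. X \<in> UT2 \<and> log_mean_field m w A X = 0)"

(* Membership of every iterate in UT2 is required explicitly, since mat_log is a total function
   that carries no information outside UT2. *)
definition projection_mean_iteration ::
    "nat \<Rightarrow> (nat \<Rightarrow> real) \<Rightarrow> (nat \<Rightarrow> real^2^2) \<Rightarrow> real \<Rightarrow> real^2^2 \<Rightarrow> (nat \<Rightarrow> real^2^2) \<Rightarrow> bool" where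
  "projection_mean_iteration m w A c X0 X \<longleftrightarrow>
     X 0 = X0 \<and> (\<forall>k. X k \<in> UT2) \<and>
     (\<forall>k. mat_log (matrix_inv (X k) ** X (Suc k)) = (1 / c) *\<^sub>R log_mean_field m w A (X k))"

end

theory Submission
  imports Defs
begin

text \<open>
  Once \<open>diag X\<^sub>0 = D\<close>, the diagonal part of the mean field vanishes, so every iterate keeps the
  diagonal \<open>D\<close>. The off-diagonal entry of the mean field is affine in that of \<open>X\<close> with slope
  \<open>-c\<^sub>0\<close> (up to the scale of \<open>D\<close>), so the distance to the Karcher mean is multiplied by
  \<open>1 - c\<^sub>0/c\<close> in each step. It tends to zero iff \<open>\<bar>1 - c\<^sub>0/c\<bar> < 1\<close>, that is, \<open>c > c\<^sub>0/2\<close>;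
  otherwise the factor is at most \<open>-1\<close> and the iterates oscillate. The convex function
  \<open>u / (e\<^sup>u - 1)\<close> lies above its tangent \<open>1 - u/2\<close> at \<open>0\<close>, which gives \<open>c\<^sub>0 \<ge> 1\<close> because the
  weighted logarithms of the diagonal ratios cancel; spreading two diagonal ratios far apart makes
  \<open>c\<^sub>0\<close> arbitrarily large.
\<close>

section \<open>Upper triangular matrices in coordinates\<close>

definition ut :: "real \<Rightarrow> real \<Rightarrow> real \<Rightarrow> real^2^2" where
  "ut a b d = (\<chi> i j. if i = 1 then (if j = 1 then a else b) else (if j = 1 then 0 else d))"

lemma ut_nth [simp]:
  "ut a b d $ 1 $ 1 = a" "ut a b d $ 1 $ 2 = b" "ut a b d $ 2 $ 1 = 0" "ut a b d $ 2 $ 2 = d"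
  by (simp_all add: ut_def)

lemma matrix2_eq_iff:
  fixes A B :: "real^2^2"
  shows "A = B \<longleftrightarrow> A $ 1 $ 1 = B $ 1 $ 1 \<and> A $ 1 $ 2 = B $ 1 $ 2 \<and> A $ 2 $ 1 = B $ 2 $ 1 \<and> A $ 2 $ 2 = B $ 2 $ 2"
  by (auto simp: vec_eq_iff forall_2)

lemma ut_eq_iff [simp]: "ut a b d = ut a' b' d' \<longleftrightarrow> a = a' \<and> b = b' \<and> d = d'"
  by (auto simp: matrix2_eq_iff)

lemma upper_triangular2_ut [simp]: "upper_triangular2 (ut a b d)"
  by (simp add: upper_triangular2_def)

lemma ut_in_UT2 [simp]: "ut a b d \<in> UT2 \<longleftrightarrow> a > 0 \<and> d > 0"
  by (simp add: UT2_def)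

lemma upper_triangular2_ut_entries:
  "upper_triangular2 L \<Longrightarrow> L = ut (L $ 1 $ 1) (L $ 1 $ 2) (L $ 2 $ 2)"
  by (auto simp: matrix2_eq_iff upper_triangular2_def)

lemma UT2_ut_entries: "A \<in> UT2 \<Longrightarrow> A = ut (A $ 1 $ 1) (A $ 1 $ 2) (A $ 2 $ 2)"
  by (auto simp: matrix2_eq_iff UT2_def)

lemma ut_mult: "ut a b d ** ut a' b' d' = ut (a * a') (a * b' + b * d') (d * d')"
  by (simp add: matrix2_eq_iff matrix_matrix_mult_def sum_2)

lemma mat_1_ut: "mat 1 = ut 1 0 1"
  by (simp add: matrix2_eq_iff mat_def)

lemma ut_scaleR: "k *\<^sub>R ut a b d = ut (k * a) (k * b) (k * d)"
  by (simp add: matrix2_eq_iff)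

lemma ut_sum: "(\<Sum>i\<in>I. ut (a i) (b i) (d i)) = ut (sum a I) (sum b I) (sum d I)"
  by (simp add: matrix2_eq_iff)

lemma ut_zero: "0 = ut 0 0 0"
  by (simp add: matrix2_eq_iff)

lemma diag_part_ut [simp]: "diag_part (ut a b d) = ut a 0 d"
  by (simp add: matrix2_eq_iff diag_part_def)

text \<open>Linearity in three fixed matrices lets limits of entries become limits of
  matrices.\<close>

lemma ut_decomp: "ut a b d = a *\<^sub>R ut 1 0 0 + b *\<^sub>R ut 0 1 0 + d *\<^sub>R ut 0 0 1"
  by (simp add: matrix2_eq_iff)

lemma ut_sums:
  assumes "a sums a'" "b sums b'" "d sums d'"
  shows "(\<lambda>n. ut (a n) (b n) (d n)) sums ut a' b' d'"
  unfolding ut_decomp[of "a _"] ut_decomp[of a']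
  by (intro sums_add sums_scaleR_left assms)

lemma tendsto_ut:
  assumes "(b \<longlongrightarrow> b') F"
  shows "((\<lambda>n. ut a (b n) d) \<longlongrightarrow> ut a b' d) F"
  unfolding ut_decomp[of a "b _"] ut_decomp[of a b']
  by (intro tendsto_intros assms)

lemma matrix_inv_ut:
  assumes "a \<noteq> 0" "d \<noteq> 0"
  shows "matrix_inv (ut a b d) = ut (1 / a) (- b / (a * d)) (1 / d)"
proof -
  let ?M = "ut a b d" and ?N = "ut (1 / a) (- b / (a * d)) (1 / d)"
  have MN: "?M ** ?N = mat 1" "?N ** ?M = mat 1"
    using assms by (simp_all add: ut_mult mat_1_ut)
  \<comment> \<open>\<open>matrix_inv\<close> is a choice among two-sided inverses; the witness
    \<open>?N\<close> makes that choice valid, and associativity then identifies it.\<close>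
  then have inv: "matrix_inv ?M ** ?M = mat 1"
    unfolding matrix_inv_def by (metis (mono_tags, lifting) someI)
  have "matrix_inv ?M = matrix_inv ?M ** (?M ** ?N)"
    by (simp only: MN(1) matrix_mul_rid)
  also have "\<dots> = ?N"
    by (simp only: matrix_mul_assoc inv matrix_mul_lid)
  finally show ?thesis .
qed

section \<open>Exponential, logarithm and real powers of triangular matrices\<close>

definition exp_quot :: "real \<Rightarrow> real \<Rightarrow> real" where
  "exp_quot p r = (if p = r then exp p else (exp p - exp r) / (p - r))"

text \<open>A product of \<open>n\<close> factors reaches the upper right entry by using
  \<open>q\<close> exactly once, with \<open>i\<close> factors \<open>p\<close> before it and
  \<open>n - 1 - i\<close> factors \<open>r\<close> after it.\<close>

lemma mat_power_ut:
  "((\<lambda>P. ut p q r ** P) ^^ n) (mat 1) = ut (p ^ n) (q * (\<Sum>i<n. p ^ i * r ^ (n - Suc i))) (r ^ n)"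
proof (induction n)
  case 0
  then show ?case by (simp add: mat_1_ut)
next
  case (Suc n)
  have "(\<Sum>i<Suc n. p ^ i * r ^ (Suc n - Suc i)) = r ^ n + p * (\<Sum>i<n. p ^ i * r ^ (n - Suc i))"
    unfolding sum.lessThan_Suc_shift by (simp add: sum_distrib_left mult.assoc)
  with Suc show ?case by (simp add: ut_mult algebra_simps)
qed

lemma exp_quot_sums:
  "(\<lambda>n. (1 / fact n) * (\<Sum>i<n. p ^ i * r ^ (n - Suc i))) sums exp_quot p r"
proof (cases "p = r")
  case True
  have "(\<lambda>n. p ^ n / fact n) sums exp p"
    using exp_converges[of p] by (simp add: divide_inverse mult.commute)
  \<comment> \<open>The \<open>n + 1\<close> equal summands cancel one factor of
    \<open>fact (Suc n)\<close>; \<open>sums_Suc\<close> then prepends the term at 0, an empty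
    sum.\<close>
  moreover have "p ^ n / fact n = (1 / fact (Suc n)) * (\<Sum>i<Suc n. p ^ i * r ^ (Suc n - Suc i))" for n
  proof -
    have "(\<Sum>i<Suc n. p ^ i * r ^ (Suc n - Suc i)) = (\<Sum>i<Suc n. p ^ n)"
      using True by (intro sum.cong) (auto simp flip: power_add)
    also have "\<dots> = real (Suc n) * p ^ n" by simp
    finally show ?thesis by (simp only: fact_Suc of_nat_mult) simp
  qed
  ultimately have "(\<lambda>n. (1 / fact (Suc n)) * (\<Sum>i<Suc n. p ^ i * r ^ (Suc n - Suc i))) sums exp p"
    by simp
  from sums_Suc[OF this] show ?thesis using True by (simp add: exp_quot_def)
next
  case False
  have "(\<lambda>n. ((1 / fact n) * p ^ n - (1 / fact n) * r ^ n) / (p - r)) sums ((exp p - exp r) / (p - r))"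
    using exp_converges[of p] exp_converges[of r]
    by (intro sums_divide sums_diff) (simp_all add: divide_inverse)
  moreover have "((1 / fact n) * p ^ n - (1 / fact n) * r ^ n) / (p - r)
      = (1 / fact n) * (\<Sum>i<n. p ^ i * r ^ (n - Suc i))" for n
  proof -
    have "p ^ n - r ^ n = (p - r) * (\<Sum>i<n. p ^ i * r ^ (n - Suc i))"
      using power_diff_sumr2[of p n r] by (simp add: mult.commute)
    then have "(p ^ n - r ^ n) / (p - r) = (\<Sum>i<n. p ^ i * r ^ (n - Suc i))"
      using False by simp
    then show ?thesis
      by (simp only: right_diff_distrib[symmetric] times_divide_eq_right[symmetric])
  qed
  ultimately show ?thesis using False by (simp add: exp_quot_def)
qed

lemma mat_exp_ut: "mat_exp (ut p q r) = ut (exp p) (q * exp_quot p r) (exp r)"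
proof -
  have "(\<lambda>n. (1 / fact n) *\<^sub>R ((\<lambda>P. ut p q r ** P) ^^ n) (mat 1)) sums
      ut (exp p) (q * exp_quot p r) (exp r)"
    unfolding mat_power_ut ut_scaleR
    using sums_mult[OF exp_quot_sums[of p r], of q] exp_converges[of p] exp_converges[of r]
    by (intro ut_sums) (simp_all add: divide_inverse mult.left_commute)
  then show ?thesis by (simp add: mat_exp_def sums_iff)
qed

text \<open>Divided differences of inverse functions at corresponding points are reciprocal; the
  values chosen for \<open>p = r\<close> are the derivatives and obey the same rule.\<close>

lemma log_quot_exp: "log_quot (exp p) (exp r) * exp_quot p r = 1"
  by (simp add: log_quot_def exp_quot_def)

lemma log_quot_pos:
  assumes "x > 0" "y > 0"
  shows "log_quot x y > 0"
  using assms by (cases x y rule: linorder_cases)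
    (auto simp: log_quot_def intro: divide_neg_neg divide_pos_pos)

text \<open>Injectivity of the real \<open>exp\<close> fixes the diagonal of \<open>L\<close>. What
  remains is linear in the upper right entry, with the factor \<open>exp_quot\<close>, whose
  reciprocal is \<open>log_quot\<close>.\<close>

lemma mat_log_ut:
  assumes "a > 0" "d > 0"
  shows "mat_log (ut a b d) = ut (ln a) (b * log_quot a d) (ln d)"
  unfolding mat_log_def
proof (rule the_equality)
  have inv: "log_quot a d * exp_quot (ln a) (ln d) = 1"
    using log_quot_exp[of "ln a" "ln d"] assms by simp
  then show "upper_triangular2 (ut (ln a) (b * log_quot a d) (ln d)) \<and>
      mat_exp (ut (ln a) (b * log_quot a d) (ln d)) = ut a b d"
    using assms by (simp add: mat_exp_ut mult.assoc)
  fix L assume L: "upper_triangular2 L \<and> mat_exp L = ut a b d"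
  obtain p q r where Lut: "L = ut p q r"
    using L upper_triangular2_ut_entries by blast
  with L have "exp p = a" "exp r = d" and b: "q * exp_quot p r = b"
    by (auto simp: mat_exp_ut)
  then have pr: "p = ln a" "r = ln d" by auto
  have "b * log_quot a d = q"
    using inv unfolding b[symmetric] pr by (simp only: mult.assoc mult.commute[of "exp_quot _ _"] mult_1_right)
  with pr Lut show "L = ut (ln a) (b * log_quot a d) (ln d)" by simp
qed

lemma mat_rpow_ut:
  assumes "a > 0" "d > 0"
  obtains b' where "mat_rpow (ut a b d) t = ut (exp (t * ln a)) b' (exp (t * ln d))"
  using assms by (simp add: mat_rpow_def mat_log_ut ut_scaleR mat_exp_ut)

lemma foldr_rpow_ut:
  assumes "\<And>i. i \<in> set js \<Longrightarrow> A i \<in> UT2"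
  shows "\<exists>b. foldr (\<lambda>i P. mat_rpow (A i) (w i) ** P) js (mat 1) =
     ut (exp (\<Sum>i\<leftarrow>js. w i * ln (A i $ 1 $ 1))) b (exp (\<Sum>i\<leftarrow>js. w i * ln (A i $ 2 $ 2)))"
  using assms
proof (induction js)
  case Nil
  then show ?case by (auto simp: mat_1_ut)
next
  case (Cons j js)
  have Aj: "A j \<in> UT2" using Cons.prems by simp
  then have "A j $ 1 $ 1 > 0" "A j $ 2 $ 2 > 0" by (auto simp: UT2_def)
  then obtain b where b: "mat_rpow (A j) (w j) = ut (exp (w j * ln (A j $ 1 $ 1))) b (exp (w j * ln (A j $ 2 $ 2)))"
    by (rule mat_rpow_ut[of _ _ "A j $ 1 $ 2" "w j"]) (simp only: UT2_ut_entries[OF Aj, symmetric])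
  obtain b' where b': "foldr (\<lambda>i P. mat_rpow (A i) (w i) ** P) js (mat 1) =
      ut (exp (\<Sum>i\<leftarrow>js. w i * ln (A i $ 1 $ 1))) b' (exp (\<Sum>i\<leftarrow>js. w i * ln (A i $ 2 $ 2)))"
    using Cons by auto
  show ?case
    by (simp add: b b' ut_mult exp_add)
qed

section \<open>Bounds for the logarithmic quotient\<close>

lemma exp_minus_one_le: "(u::real) / 2 * (exp u + 1) \<ge> exp u - 1" if "u \<ge> 0"
proof -
  \<comment> \<open>The excess of the trapezoid rule over the integral of \<open>exp\<close> on
    \<open>[0, u]\<close>; it vanishes at 0 and is shown to be nondecreasing.\<close>
  let ?g = "\<lambda>u::real. u / 2 * (exp u + 1) - (exp u - 1)"
  have "?g 0 \<le> ?g u"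
  proof (rule DERIV_nonneg_imp_nondecreasing[OF that])
    fix v :: real assume "0 \<le> v"
    have "(?g has_real_derivative ((exp v + 1) / 2 + v / 2 * exp v - exp v)) (at v)"
      by (auto intro!: derivative_eq_intros)
    moreover have "(exp v + 1) / 2 + v / 2 * exp v - exp v \<ge> 0"
    proof -
      have "1 - v \<le> exp (- v)" using exp_ge_add_one_self[of "-v"] by simp
      then have "(1 - v) * exp v \<le> exp (- v) * exp v" by (intro mult_right_mono) auto
      then show ?thesis by (simp add: exp_minus field_simps)
    qed
    ultimately show "\<exists>y. (?g has_real_derivative y) (at v) \<and> 0 \<le> y" by blast
  qed
  then show ?thesis by simp
qed

text \<open>With \<open>u = ln t\<close> the quotient is \<open>u / (exp u - 1)\<close>, bounded
  below by its tangent at 0. Both signs of \<open>u\<close> reduce to the trapezoid bound, the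
  negative one through \<open>1 / t\<close>.\<close>

lemma log_quot_one_ge:
  assumes "t > 0"
  shows "log_quot t 1 \<ge> 1 - ln t / 2"
proof (cases t "1::real" rule: linorder_cases)
  case greater
  then have "ln t / 2 * (t + 1) \<ge> t - 1"
    using exp_minus_one_le[of "ln t"] assms by simp
  with greater show ?thesis by (simp add: log_quot_def field_simps)
next
  case less
  have "- ln t / 2 * (1 / t + 1) \<ge> 1 / t - 1"
    using exp_minus_one_le[of "- ln t"] assms less by (simp add: exp_minus field_simps)
  from mult_left_mono[OF this, of t] assms have "- ln t / 2 * (1 + t) \<ge> 1 - t"
    by (simp add: algebra_simps)
  with less assms show ?thesis by (simp add: log_quot_def field_simps)
qed (simp add: log_quot_def)

text \<open>The quotient equals \<open>u / (1 - exp (- u))\<close>, whose denominator lies between 0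
  and 1. This growth makes \<open>crit_const\<close> as large as the counterexample
  requires.\<close>

lemma log_quot_exp_minus_ge:
  assumes "u > 0"
  shows "u \<le> log_quot (exp (- u)) 1"
proof -
  have "u * (exp (- u) - 1) \<ge> u * (- 1)"
    using assms by (intro mult_left_mono) auto
  then have "u \<le> - u / (exp (- u) - 1)"
    using assms by (subst neg_le_divide_eq) auto
  then show ?thesis using assms by (simp add: log_quot_def)
qed

text \<open>Symmetry and homogeneity of degree -1 of \<open>log_quot\<close>; links the quotient in
  \<open>crit_const\<close> to the one in \<open>mat_log_ut\<close>.\<close>

lemma log_quot_scale:
  assumes "a > 0" "d > 0"
  shows "log_quot (d / a) 1 = a * log_quot a d"
  using assms by (auto simp: log_quot_def ln_div field_simps)

lemma log_quot_mult_diff: "(a - d) * log_quot a d = ln a - ln d"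
  by (simp add: log_quot_def)

section \<open>Geometric error sequences\<close>

lemma geometric_error_limits:
  fixes e :: "nat \<Rightarrow> real"
  assumes "\<And>k. e (Suc k) = r * e k"
  shows "\<bar>r\<bar> < 1 \<Longrightarrow> e \<longlonglongrightarrow> 0" and "r \<le> -1 \<Longrightarrow> e 0 \<noteq> 0 \<Longrightarrow> \<not> convergent e"
proof -
  have e: "e k = r ^ k * e 0" for k
    by (induction k) (simp_all add: assms)
  show "e \<longlonglongrightarrow> 0" if "\<bar>r\<bar> < 1"
  proof -
    have "(\<lambda>k. r ^ k * e 0) \<longlonglongrightarrow> 0"
      using that by (intro tendsto_mult_left_zero LIMSEQ_power_zero) simp
    then show ?thesis by (simp only: e[symmetric])
  qed
  show "\<not> convergent e" if r: "r \<le> -1" and e0: "e 0 \<noteq> 0"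
  proof
    assume "convergent e"
    then obtain l where l: "e \<longlonglongrightarrow> l" by (auto simp: convergent_def)
    then have "(\<lambda>k. e (Suc k) - e k) \<longlonglongrightarrow> 0"
      using tendsto_diff[OF LIMSEQ_Suc[OF l] l] by simp
    then have lim: "(\<lambda>k. \<bar>e (Suc k) - e k\<bar>) \<longlonglongrightarrow> 0"
      by (rule tendsto_rabs_zero)
    \<comment> \<open>Consecutive terms stay at least \<open>\<bar>e 0\<bar>\<close> apart, even in
      the borderline case \<open>r = -1\<close>, whereas convergence forces the gaps to 0.\<close>
    have "\<bar>e (Suc k) - e k\<bar> \<ge> \<bar>e 0\<bar>" for k
    proof -
      have "e (Suc k) - e k = (r - 1) * r ^ k * e 0"
        using e[of "Suc k"] e[of k] by (simp add: left_diff_distrib)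
      then have "\<bar>e (Suc k) - e k\<bar> = \<bar>r - 1\<bar> * \<bar>r\<bar> ^ k * \<bar>e 0\<bar>"
        by (simp add: abs_mult power_abs)
      moreover have "1 * 1 \<le> \<bar>r - 1\<bar> * \<bar>r\<bar> ^ k"
        using r by (intro mult_mono one_le_power) auto
      ultimately show ?thesis by (simp add: mult_le_cancel_right1)
    qed
    then have "\<bar>e 0\<bar> \<le> 0"
      using LIMSEQ_le_const[OF lim, of "\<bar>e 0\<bar>"] by blast
    with e0 show False by simp
  qed
qed

section \<open>Mean field, critical constant and Karcher mean in coordinates\<close>

locale karcher_data =
  fixes m :: nat and w :: "nat \<Rightarrow> real" and A :: "nat \<Rightarrow> real^2^2"
  assumes prob: "prob_vector m w" and A_UT2: "\<And>i. i \<in> {1..m} \<Longrightarrow> A i \<in> UT2"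
begin

abbreviation "a i \<equiv> A i $ 1 $ 1"
abbreviation "b i \<equiv> A i $ 1 $ 2"
abbreviation "d i \<equiv> A i $ 2 $ 2"

text \<open>\<open>p\<close> and \<open>q\<close> are weighted geometric means of the diagonal
  entries; \<open>diag_prod_ut\<close> shows that they form the diagonal of D.\<close>

definition "p = exp (\<Sum>i=1..m. w i * ln (a i))"
definition "q = exp (\<Sum>i=1..m. w i * ln (d i))"

abbreviation "c0 \<equiv> crit_const m w A"

text \<open>The root of the affine function that the upper right entry of the mean field becomes
  once the diagonal is \<open>p\<close>, \<open>q\<close>.\<close>

definition "x_star = (\<Sum>i=1..m. w i * (b i * log_quot (a i / p) (d i / q))) / c0"

lemma p_pos [simp]: "p > 0" and q_pos [simp]: "q > 0"
  by (simp_all add: p_def q_def)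

lemma p_q_nz [simp]: "p \<noteq> 0" "q \<noteq> 0"
  by (simp_all add: p_def q_def)

lemma w_nonneg: "i \<in> {1..m} \<Longrightarrow> w i \<ge> 0" and w_sum: "sum w {1..m} = 1"
  using prob by (auto simp: prob_vector_def)

lemma A_pos: "i \<in> {1..m} \<Longrightarrow> a i > 0" "i \<in> {1..m} \<Longrightarrow> d i > 0"
  and A_ut: "i \<in> {1..m} \<Longrightarrow> A i = ut (a i) (b i) (d i)"
  using A_UT2[of i] UT2_ut_entries[of "A i"] by (auto simp: UT2_def)

lemma diag_prod_ut: "diag_prod m w A = ut p 0 q"
proof -
  have "A i \<in> UT2" if "i \<in> set [1..<Suc m]" for i
    using that by (intro A_UT2) auto
  from foldr_rpow_ut[of "[1..<Suc m]" A, OF this] obtain b' where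
    "weighted_prod m w A = ut (exp (\<Sum>i\<leftarrow>[1..<Suc m]. w i * ln (a i))) b'
       (exp (\<Sum>i\<leftarrow>[1..<Suc m]. w i * ln (d i)))"
    unfolding weighted_prod_def by blast
  moreover have "(\<Sum>i\<leftarrow>[1..<Suc m]. g i) = (\<Sum>i=1..m. g i)" for g :: "nat \<Rightarrow> real"
    by (simp only: interv_sum_list_conv_sum_set_nat set_upt atLeastLessThanSuc_atLeastAtMost)
  ultimately show ?thesis by (simp add: diag_prod_def p_def q_def)
qed

lemma crit_const_eq: "c0 = (\<Sum>i=1..m. w i * log_quot ((d i / q) / (a i / p)) 1)"
  unfolding crit_const_def diag_prod_ut Let_def
proof (intro sum.cong refl)
  fix i assume i: "i \<in> {1..m}"
  have "matrix_inv (ut p 0 q) ** A i = ut (a i / p) (b i / p) (d i / q)"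
    by (subst A_ut[OF i]) (simp add: matrix_inv_ut ut_mult)
  then show "w i * log_quot ((matrix_inv (ut p 0 q) ** A i) $ 2 $ 2 / (matrix_inv (ut p 0 q) ** A i) $ 1 $ 1) 1
      = w i * log_quot ((d i / q) / (a i / p)) 1"
    by simp
qed

text \<open>An arbitrary diagonal is allowed because uniqueness of the Karcher mean must first
  exclude diagonals other than that of D. The weights sum to 1, which separates \<open>ln y\<close>
  and \<open>ln z\<close> from the sums.\<close>

lemma log_mean_field_ut:
  assumes "y > 0" "z > 0"
  shows "log_mean_field m w A (ut y x z) =
    ut (ln p - ln y) (\<Sum>i=1..m. w i * ((b i / y - x * d i / (y * z)) * log_quot (a i / y) (d i / z)))
       (ln q - ln z)"
proof -
  have "log_mean_field m w A (ut y x z) = (\<Sum>i=1..m. ut (w i * ln (a i / y))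
      (w i * ((b i / y - x * d i / (y * z)) * log_quot (a i / y) (d i / z))) (w i * ln (d i / z)))"
    unfolding log_mean_field_def
  proof (intro sum.cong refl)
    fix i assume i: "i \<in> {1..m}"
    have "matrix_inv (ut y x z) ** A i = ut (a i / y) (b i / y - x * d i / (y * z)) (d i / z)"
      using assms by (subst A_ut[OF i]) (simp add: matrix_inv_ut ut_mult)
    then show "w i *\<^sub>R mat_log (matrix_inv (ut y x z) ** A i) = ut (w i * ln (a i / y))
      (w i * ((b i / y - x * d i / (y * z)) * log_quot (a i / y) (d i / z))) (w i * ln (d i / z))"
      using A_pos[OF i] assms by (simp add: mat_log_ut ut_scaleR)
  qed
  moreover have "(\<Sum>i=1..m. w i * ln (g i / y)) = (\<Sum>i=1..m. w i * ln (g i)) - ln y"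
    if "y > 0" "\<And>i. i \<in> {1..m} \<Longrightarrow> g i > 0" for g y
  proof -
    have "(\<Sum>i=1..m. w i * ln (g i / y)) = (\<Sum>i=1..m. w i * ln (g i) - w i * ln y)"
      using that by (intro sum.cong refl) (simp add: ln_divide_pos right_diff_distrib)
    then show ?thesis
      by (simp add: sum_subtractf w_sum[simplified] flip: sum_distrib_right)
  qed
  ultimately show ?thesis
    using assms A_pos by (simp add: ut_sum p_def q_def)
qed

text \<open>Dividing by the weighted geometric means \<open>p\<close> and \<open>q\<close> centres
  the logarithms. Both \<open>crit_const_ge_1\<close> and \<open>crit_const_alt\<close> rest on this
  cancellation.\<close>

lemma sum_w_ln_zero: "(\<Sum>i=1..m. w i * ln ((d i / q) / (a i / p))) = 0"
proof -
  have "(\<Sum>i=1..m. w i * ln ((d i / q) / (a i / p)))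
      = (\<Sum>i=1..m. w i * ln (d i) - w i * ln (a i) - w i * (ln q - ln p))"
  proof (intro sum.cong refl)
    fix i assume "i \<in> {1..m}"
    then have "ln ((d i / q) / (a i / p)) = ln (d i) - ln (a i) - (ln q - ln p)"
      using A_pos by (simp add: ln_divide_pos ln_mult_pos)
    then show "w i * ln ((d i / q) / (a i / p)) = w i * ln (d i) - w i * ln (a i) - w i * (ln q - ln p)"
      by (simp only: right_diff_distrib)
  qed
  also have "\<dots> = 0"
    by (simp add: sum_subtractf w_sum[simplified] p_def q_def flip: sum_distrib_right)
  finally show ?thesis .
qed

text \<open>Averaging the tangent bound leaves only its constant term. The result gives the
  threshold 1/2 and also justifies dividing by \<open>c0\<close>.\<close>

lemma crit_const_ge_1: "c0 \<ge> 1"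
proof -
  have "(\<Sum>i=1..m. w i * (1 - ln ((d i / q) / (a i / p)) / 2)) \<le> c0"
    unfolding crit_const_eq using A_pos w_nonneg
    by (intro sum_mono mult_left_mono log_quot_one_ge) auto
  moreover have "(\<Sum>i=1..m. w i * (1 - ln ((d i / q) / (a i / p)) / 2))
      = sum w {1..m} - (\<Sum>i=1..m. w i * ln ((d i / q) / (a i / p))) / 2"
    by (simp add: algebra_simps sum_subtractf sum_divide_distrib)
  ultimately show ?thesis by (simp only: sum_w_ln_zero w_sum)
qed

text \<open>The slope of the mean field carries the factor \<open>d\<^sub>i / q\<close> where \<open>c\<^sub>0\<close> carries \<open>a\<^sub>i / p\<close>; the two
  sums differ by the weighted sum of \<open>ln (d\<^sub>i / q) - ln (a\<^sub>i / p)\<close>, which vanishes.\<close>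
lemma crit_const_alt: "c0 = (\<Sum>i=1..m. w i * (d i / q * log_quot (a i / p) (d i / q)))"
proof -
  have "c0 = (\<Sum>i=1..m. w i * (d i / q * log_quot (a i / p) (d i / q))
      - w i * ln ((d i / q) / (a i / p)))"
    unfolding crit_const_eq
  proof (intro sum.cong refl)
    fix i assume i: "i \<in> {1..m}"
    let ?a = "a i / p" and ?d = "d i / q"
    have pos: "?a > 0" "?d > 0" using A_pos[OF i] by auto
    have "?a * log_quot ?a ?d = ?d * log_quot ?a ?d - ln (?d / ?a)"
      using log_quot_mult_diff[of ?a ?d] ln_divide_pos[OF pos(2,1)] by (simp only: left_diff_distrib)
    then show "w i * log_quot (?d / ?a) 1 = w i * (?d * log_quot ?a ?d) - w i * ln (?d / ?a)"
      using log_quot_scale[OF pos] by (simp only: right_diff_distrib)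
  qed
  then show ?thesis by (simp only: sum_subtractf sum_w_ln_zero)
qed

lemma log_mean_field_diag: "log_mean_field m w A (ut p x q) = ut 0 (c0 * (x_star - x) / p) 0"
proof -
  have c0: "c0 \<noteq> 0" using crit_const_ge_1 by auto
  have "(\<Sum>i=1..m. w i * ((b i / p - x * d i / (p * q)) * log_quot (a i / p) (d i / q)))
     = (\<Sum>i=1..m. w i * (b i * log_quot (a i / p) (d i / q)) / p
          - x / p * (w i * (d i / q * log_quot (a i / p) (d i / q))))"
    by (intro sum.cong refl) (simp add: field_simps)
  also have "\<dots> = c0 * x_star / p - x / p * c0"
    unfolding sum_subtractf sum_distrib_left[symmetric] sum_divide_distrib[symmetric]
      crit_const_alt[symmetric] using c0 by (simp add: x_star_def)
  also have "\<dots> = c0 * (x_star - x) / p"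
    by (simp add: field_simps)
  finally show ?thesis by (simp add: log_mean_field_ut)
qed

text \<open>The logarithms on the diagonal force \<open>y = p\<close> and \<open>z = q\<close>; then
  the nonzero slope leaves only \<open>x_star\<close>.\<close>

lemma karcher_mean_ut: "karcher_mean m w A = ut p x_star q"
  unfolding karcher_mean_def
proof (rule the_equality)
  show "ut p x_star q \<in> UT2 \<and> log_mean_field m w A (ut p x_star q) = 0"
    by (simp add: log_mean_field_diag ut_zero)
  fix X assume X: "X \<in> UT2 \<and> log_mean_field m w A X = 0"
  then obtain y x z where Xut: "X = ut y x z" and pos: "y > 0" "z > 0"
    using UT2_ut_entries unfolding UT2_def by blast
  then have "log_mean_field m w A (ut y x z) = ut 0 0 0"
    using X ut_zero by simp
  then have "ln p - ln y = 0" "ln q - ln z = 0"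
    unfolding log_mean_field_ut[OF pos] ut_eq_iff by blast+
  then have yz: "y = p" "z = q" using pos by auto
  have "log_mean_field m w A (ut p x q) = ut 0 0 0"
    using X ut_zero unfolding Xut yz by simp
  then have "c0 * (x_star - x) / p = 0"
    unfolding log_mean_field_diag ut_eq_iff by blast
  then have "x = x_star" using crit_const_ge_1 by auto
  then show "X = ut p x_star q" unfolding Xut yz by (rule arg_cong)
qed

section \<open>The iteration as a scalar affine recursion\<close>

lemma iteration_step_iff:
  assumes "X' \<in> UT2" and "c > 0"
  shows "mat_log (matrix_inv (ut p x q) ** X') = (1 / c) *\<^sub>R log_mean_field m w A (ut p x q)
    \<longleftrightarrow> X' = ut p (x_star + (1 - c0 / c) * (x - x_star)) q"
proof -
  obtain y x' z where X': "X' = ut y x' z" and pos: "y > 0" "z > 0"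
    using assms UT2_ut_entries unfolding UT2_def by blast
  have step: "mat_log (matrix_inv (ut p x q) ** X')
      = ut (ln (y / p)) ((x' / p - x * z / (p * q)) * log_quot (y / p) (z / q)) (ln (z / q))"
    using pos by (simp add: X' matrix_inv_ut ut_mult mat_log_ut)
  have field: "(1 / c) *\<^sub>R log_mean_field m w A (ut p x q) = ut 0 (c0 * (x_star - x) / (p * c)) 0"
    by (simp add: log_mean_field_diag ut_scaleR mult.commute)
  show ?thesis
  proof (cases "y = p \<and> z = q")
    \<comment> \<open>With equal diagonals the logarithm is that of a matrix with unit diagonal,
      where \<open>log_quot 1 1 = 1\<close>, so the equation is linear in \<open>x'\<close>.\<close>
    case True
    have "(x' / p - x / p) = c0 * (x_star - x) / (p * c) \<longleftrightarrow> (x' - x) / p = (c0 * (x_star - x) / c) / p"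
      by (simp add: diff_divide_distrib mult.commute)
    also have "\<dots> \<longleftrightarrow> x' - x = c0 * (x_star - x) / c"
      by (simp only: divide_cancel_right p_q_nz simp_thms)
    also have "\<dots> \<longleftrightarrow> x' = x_star + (1 - c0 / c) * (x - x_star)"
    proof -
      have "x_star + (1 - c0 / c) * (x - x_star) = x + c0 * (x_star - x) / c"
        by (simp add: algebra_simps diff_divide_distrib)
      then show ?thesis by auto
    qed
    finally show ?thesis
      unfolding step field unfolding X' using True by (simp add: log_quot_def)
  next
    case False
    \<comment> \<open>A different diagonal makes both sides false: the field has zero diagonal, the
      logarithm does not.\<close>
    then have "\<not> (ln (y / p) = 0 \<and> ln (z / q) = 0)"
      using pos by auto
    with False show ?thesis
      unfolding step field unfolding X' by auto
  qed
qed

context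
  fixes c x0 X
  assumes c_pos: "c > 0" and iteration: "projection_mean_iteration m w A c (ut p x0 q) X"
begin

lemma iterates_ut: "X k = ut p (X k $ 1 $ 2) q"
proof (induction k)
  case 0
  then show ?case using iteration by (simp add: projection_mean_iteration_def)
next
  case (Suc k)
  then show ?case
    using iteration iteration_step_iff[OF _ c_pos, of "X (Suc k)" "X k $ 1 $ 2"]
    by (metis projection_mean_iteration_def ut_nth(2))
qed

lemma error_step: "X (Suc k) $ 1 $ 2 - x_star = (1 - c0 / c) * (X k $ 1 $ 2 - x_star)"
proof -
  have "X (Suc k) = ut p (x_star + (1 - c0 / c) * (X k $ 1 $ 2 - x_star)) q"
    using iteration iteration_step_iff[OF _ c_pos, of "X (Suc k)" "X k $ 1 $ 2"] iterates_ut[of k]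
    by (metis projection_mean_iteration_def)
  then show ?thesis by simp
qed

lemma iteration_converges:
  assumes "c > c0 / 2"
  shows "X \<longlonglongrightarrow> karcher_mean m w A"
proof -
  \<comment> \<open>The lower bound -1 is \<open>c > c0 / 2\<close>; the upper bound 1 is
    \<open>c0 > 0\<close>.\<close>
  have "\<bar>1 - c0 / c\<bar> < 1"
    using assms c_pos crit_const_ge_1 by (auto simp: abs_less_iff field_simps)
  from geometric_error_limits(1)[of "\<lambda>k. X k $ 1 $ 2 - x_star", OF error_step this]
  have "(\<lambda>k. X k $ 1 $ 2) \<longlonglongrightarrow> x_star"
    by (simp add: LIM_zero_iff)
  from tendsto_ut[OF this] have "(\<lambda>k. ut p (X k $ 1 $ 2) q) \<longlonglongrightarrow> karcher_mean m w A"
    unfolding karcher_mean_ut .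
  then show ?thesis by (simp only: iterates_ut[symmetric])
qed

lemma iteration_diverges:
  assumes "c \<le> c0 / 2" and "x0 \<noteq> x_star"
  shows "\<not> convergent X"
proof
  assume "convergent X"
  then obtain l where "X \<longlonglongrightarrow> l" by (auto simp: convergent_def)
  then have "(\<lambda>k. X k $ 1 $ 2 - x_star) \<longlonglongrightarrow> l $ 1 $ 2 - x_star"
    by (intro tendsto_intros)
  then have "convergent (\<lambda>k. X k $ 1 $ 2 - x_star)" by (auto simp: convergent_def)
  moreover have "1 - c0 / c \<le> -1"
    using assms c_pos by (simp add: field_simps)
  moreover have "X 0 $ 1 $ 2 - x_star \<noteq> 0"
    using iteration assms by (simp add: projection_mean_iteration_def)
  ultimately show False
    using geometric_error_limits(2)[of "\<lambda>k. X k $ 1 $ 2 - x_star", OF error_step] by blast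
qed

end

text \<open>Read from right to left, \<open>iteration_step_iff\<close> turns iterates of the scalar
  map into a genuine iteration, which the counterexample has to exhibit.\<close>

lemma iteration_exists:
  assumes "c > 0"
  obtains X where "projection_mean_iteration m w A c (ut p x0 q) X"
proof
  define x where "x = (\<lambda>k. ((\<lambda>x. x_star + (1 - c0 / c) * (x - x_star)) ^^ k) x0)"
  show "projection_mean_iteration m w A c (ut p x0 q) (\<lambda>k. ut p (x k) q)"
    unfolding projection_mean_iteration_def
  proof (intro conjI allI)
    fix k
    show "mat_log (matrix_inv (ut p (x k) q) ** ut p (x (Suc k)) q)
        = (1 / c) *\<^sub>R log_mean_field m w A (ut p (x k) q)"
      by (subst iteration_step_iff[OF _ assms]) (simp_all add: x_def)
  qed (simp_all add: x_def)
qed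

end

section \<open>A divergent instance for every step constant\<close>

lemma exists_divergent_iteration:
  assumes prob: "prob_vector m w" and jl: "j \<in> {1..m}" "l \<in> {1..m}" "j \<noteq> l" "w j > 0" "w l > 0"
    and c: "c > 0"
  obtains A X where "\<And>i. i \<in> {1..m} \<Longrightarrow> A i \<in> UT2"
    "projection_mean_iteration m w A c (diag_prod m w A) X" "\<not> convergent X"
proof -
  \<comment> \<open>With this \<open>t\<close> the summand of index \<open>j\<close> alone makes
    \<open>c0\<close> at least \<open>2 * c\<close>. The entry at \<open>l\<close> offsets the one
    at \<open>j\<close> in the weighted logarithms, so D is the identity, and the off-diagonal 1 at
    \<open>j\<close> moves the Karcher mean away from D.\<close>
  define t where "t = 2 * c"
  define A where "A = (\<lambda>i. if i = j then ut 1 1 (exp (- (t / w j)))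
      else if i = l then ut 1 0 (exp (t / w l)) else ut 1 0 1)"
  interpret karcher_data m w A
    using prob by unfold_locales (auto simp: A_def)
  have aA: "a i = 1" for i by (simp add: A_def)
  have "(\<Sum>i=1..m. w i * ln (d i)) = (\<Sum>i\<in>{1..m}. (if i = j then - t else 0) + (if i = l then t else 0))"
    using jl by (intro sum.cong) (auto simp: A_def)
  also have "\<dots> = 0"
    using jl by (simp add: sum.distrib)
  finally have q1: "q = 1" by (simp add: q_def)
  have p1: "p = 1" by (simp add: p_def aA)
  have "t \<le> w j * log_quot (exp (- (t / w j))) 1"
  proof -
    have "t / w j > 0" using c jl by (simp add: t_def)
    from mult_left_mono[OF log_quot_exp_minus_ge[OF this], of "w j"] show ?thesis
      using jl by simp
  qed
  also have "\<dots> = w j * log_quot (d j) 1" by (simp add: A_def)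
  also have "\<dots> \<le> c0"
  proof -
    have "0 \<le> w i * log_quot (d i) 1" if "i \<in> {1..m} - {j}" for i
      using that w_nonneg[of i] log_quot_pos[of "d i" 1] A_pos(2)[of i]
      by (intro mult_nonneg_nonneg) auto
    then have "w j * log_quot (d j) 1 \<le> (\<Sum>i=1..m. w i * log_quot (d i) 1)"
      by (intro member_le_sum jl) auto
    then show ?thesis by (simp add: crit_const_eq p1 q1 aA)
  qed
  finally have le: "c \<le> c0 / 2" by (simp add: t_def)
  have "x_star \<noteq> 0"
  proof -
    have "(\<Sum>i=1..m. w i * (b i * log_quot (a i / p) (d i / q)))
        = (\<Sum>i\<in>{1..m}. if i = j then w j * log_quot 1 (d j) else 0)"
      unfolding p1 q1 aA by (intro sum.cong) (auto simp: A_def)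
    also have "\<dots> > 0"
      using jl log_quot_pos[of 1 "d j"] A_pos by simp
    finally show ?thesis using crit_const_ge_1 by (simp add: x_star_def)
  qed
  then have nz: "0 \<noteq> x_star" by (rule not_sym)
  obtain X where X: "projection_mean_iteration m w A c (ut p 0 q) X"
    using iteration_exists[OF c] .
  show ?thesis
  proof (rule that[of A X])
    show "projection_mean_iteration m w A c (diag_prod m w A) X"
      using X by (simp only: diag_prod_ut)
    show "\<not> convergent X"
      by (rule iteration_diverges[OF c X le nz])
  qed (rule A_UT2)
qed

theorem theorem2p6:
  fixes m :: nat and w :: "nat \<Rightarrow> real"
  assumes "m \<ge> 1" and "prob_vector m w"
  shows "(\<forall>(A :: nat \<Rightarrow> real^2^2) (c :: real) (X0 :: real^2^2) (X :: nat \<Rightarrow> real^2^2).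
            (\<forall>i\<in>{1..m}. A i \<in> UT2) \<longrightarrow> c > 0 \<longrightarrow>
            X0 \<in> UT2 \<longrightarrow> diag_part X0 = diag_prod m w A \<longrightarrow> X0 \<noteq> karcher_mean m w A \<longrightarrow>
            projection_mean_iteration m w A c X0 X \<longrightarrow>
              (X \<longlonglongrightarrow> karcher_mean m w A \<longleftrightarrow> c > crit_const m w A / 2) \<and>
              (c \<le> 1 / 2 \<longrightarrow> \<not> convergent X))
       \<and> (card {i\<in>{1..m}. w i > 0} \<ge> 2 \<longrightarrow>
            \<not> (\<exists>c::real. c > 0 \<and>
                 (\<forall>(A :: nat \<Rightarrow> real^2^2) (X :: nat \<Rightarrow> real^2^2).
                    (\<forall>i\<in>{1..m}. A i \<in> UT2) \<longrightarrow>
                    projection_mean_iteration m w A c (diag_prod m w A) X \<longrightarrow> convergent X)))"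
proof (intro conjI allI impI)
  fix A :: "nat \<Rightarrow> real^2^2" and c :: real and X0 X
  assume A: "\<forall>i\<in>{1..m}. A i \<in> UT2" and c: "c > 0" and X0: "X0 \<in> UT2"
    "diag_part X0 = diag_prod m w A" "X0 \<noteq> karcher_mean m w A"
    and it: "projection_mean_iteration m w A c X0 X"
  interpret karcher_data m w A
    using assms A by unfold_locales auto
  obtain y x0 z where "X0 = ut y x0 z" using UT2_ut_entries X0(1) by blast
  \<comment> \<open>Only the upper right entry remains free, so differing from the Karcher mean
    becomes \<open>x0 \<noteq> x_star\<close>.\<close>
  with X0(2) have X0_ut: "X0 = ut p x0 q" by (simp add: diag_prod_ut)
  with X0(3) have x0: "x0 \<noteq> x_star" by (simp add: karcher_mean_ut)
  note it = it[unfolded X0_ut]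
  show "X \<longlonglongrightarrow> karcher_mean m w A \<longleftrightarrow> c > crit_const m w A / 2"
  proof
    assume "X \<longlonglongrightarrow> karcher_mean m w A"
    \<comment> \<open>At or below the threshold every limit is excluded, so mere convergence already
      gives the bound.\<close>
    then have "convergent X" by (rule convergentI)
    then show "c > crit_const m w A / 2"
      using iteration_diverges[OF c it _ x0] by (rule contrapos_pp) simp
  qed (rule iteration_converges[OF c it])
  show "\<not> convergent X" if "c \<le> 1 / 2"
  proof (rule iteration_diverges[OF c it _ x0])
    show "c \<le> crit_const m w A / 2" using that crit_const_ge_1 by linarith
  qed
next
  assume "card {i\<in>{1..m}. w i > 0} \<ge> 2"
  then have "\<not> card {i\<in>{1..m}. w i > 0} \<le> Suc 0" by simp
  moreover have "finite {i\<in>{1..m}. w i > 0}" by simp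
  ultimately obtain j l where "j \<in> {i\<in>{1..m}. w i > 0}" "l \<in> {i\<in>{1..m}. w i > 0}" "j \<noteq> l"
    using card_le_Suc0_iff_eq by blast
  then have jl: "j \<in> {1..m}" "l \<in> {1..m}" "j \<noteq> l" "w j > 0" "w l > 0" by auto
  show "\<not> (\<exists>c::real. c > 0 \<and>
                 (\<forall>(A :: nat \<Rightarrow> real^2^2) (X :: nat \<Rightarrow> real^2^2).
                    (\<forall>i\<in>{1..m}. A i \<in> UT2) \<longrightarrow>
                    projection_mean_iteration m w A c (diag_prod m w A) X \<longrightarrow> convergent X))"
  proof
    assume "\<exists>c::real. c > 0 \<and>
                 (\<forall>(A :: nat \<Rightarrow> real^2^2) (X :: nat \<Rightarrow> real^2^2).
                    (\<forall>i\<in>{1..m}. A i \<in> UT2) \<longrightarrow>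
                    projection_mean_iteration m w A c (diag_prod m w A) X \<longrightarrow> convergent X)"
    then obtain c :: real where c: "c > 0" and conv: "\<And>A X. \<forall>i\<in>{1..m}. A i \<in> UT2 \<Longrightarrow>
        projection_mean_iteration m w A c (diag_prod m w A) X \<Longrightarrow> convergent X"
      by blast
    show False
    proof (rule exists_divergent_iteration[OF assms(2) jl c])
      fix A X
      assume "\<And>i. i \<in> {1..m} \<Longrightarrow> A i \<in> UT2"
        "projection_mean_iteration m w A c (diag_prod m w A) X" "\<not> convergent X"
      with conv[of A X] show False by blast
    qed
  qed
qed

end
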